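(* Let $f\in L([a,b];H)$, let $\{e_i\}_{i\in\{1,\dots,n\}}$ be an orthonormal family in $H$ ($n\ge1$), and let $M_i\in L[a,b]$ for $i\in\{1,\dots,n\}$. Assume that for each $i\in\{1,\dots,n\}$ $$\|f(t)\|-\operatorname{Re}\langle f(t),e_i\rangle\le M_i(t)\quad\text{for a.e. }t\in[a,b].$$ Then $$\int_a^b\|f(t)\|\,dt\le\frac1{\sqrt n}\left\|\int_a^b f(t)\,dt\right\|+\frac1n\sum_{i=1}^n\int_a^b M_i(t)\,dt .$$ Equality holds in this inequality if and only if both $$\int_a^b\|f(t)\|\,dt\ge\frac1n\sum_{i=1}^n\int_a^b M_i(t)\,dt$$ and $$\int_a^b f(t)\,dt=\left(\int_a^b\|f(t)\|\,dt-\frac1n\sum_{i=1}^n\int_a^b M_i(t)\,dt\right)\sum_{i=1}^n e_i .$$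
   Context: $[a,b]$ is a compact real interval with $a<b$; $(H;\langle\cdot,\cdot\rangle)$ is a Hilbert space over $\mathbb{K}=\mathbb{R}$ or $\mathbb{C}$ with norm $\|\cdot\|$. $L([a,b];H)$ denotes the space of Bochner integrable functions on $[a,b]$ (with Lebesgue measure) with values in $H$; integrals of $H$-valued functions are Bochner integrals. $L[a,b]$ is the space of real-valued Lebesgue integrable functions on $[a,b]$. A family $\{e_i\}$ is orthonormal if $\langle e_i,e_j\rangle=0$ for $i\ne j$ and $\|e_i\|=1$ for all $i$. *)

theory Defs
  imports "HOL-Analysis.Analysis"
begin

section \<open>Hilbert spaces over the reals or the complex numbers\<close>

text \<open>
  The scalar field is \<open>K = \<real>\<close> or \<open>K = \<complex>\<close>, both viewed as subsets of the type \<^typ>\<open>complex\<close>;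
  \<open>scl\<close> is only meaningful for scalars in \<open>K\<close>. The inner product \<open>ip\<close> takes values in \<open>K\<close> and is
  linear in its first argument. Completeness comes from the class \<^class>\<open>banach\<close>; no separability is
  assumed.
\<close>

locale hilbert_space =
  fixes K :: "complex set"
    and scl :: "complex \<Rightarrow> 'h::banach \<Rightarrow> 'h"
    and ip :: "'h \<Rightarrow> 'h \<Rightarrow> complex"
  assumes K_cases: "K = \<real> \<or> K = UNIV"
    and scl_of_real: "scl (complex_of_real r) x = r *\<^sub>R x"
    and scl_add_right: "c \<in> K \<Longrightarrow> scl c (x + y) = scl c x + scl c y"
    and scl_add_left: "c \<in> K \<Longrightarrow> d \<in> K \<Longrightarrow> scl (c + d) x = scl c x + scl d x"
    and scl_scl: "c \<in> K \<Longrightarrow> d \<in> K \<Longrightarrow> scl c (scl d x) = scl (c * d) x"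
    and ip_in_K: "ip x y \<in> K"
    and ip_add_left: "ip (x + y) z = ip x z + ip y z"
    and ip_scl_left: "c \<in> K \<Longrightarrow> ip (scl c x) y = c * ip x y"
    and ip_commute: "ip y x = cnj (ip x y)"
    and ip_self: "ip x x = complex_of_real ((norm x)\<^sup>2)"
begin

definition orthonormal_family :: "'i set \<Rightarrow> ('i \<Rightarrow> 'h) \<Rightarrow> bool" where
  "orthonormal_family I e \<longleftrightarrow>
     (\<forall>i\<in>I. \<forall>j\<in>I. i \<noteq> j \<longrightarrow> ip (e i) (e j) = 0) \<and> (\<forall>i\<in>I. norm (e i) = 1)"

end

lemma hilbert_space_real_inner:
  "hilbert_space \<real> (\<lambda>c x. Re c *\<^sub>R x)
     (\<lambda>x y::'h::{real_inner,banach}. complex_of_real (inner x y))"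
  by unfold_locales
    (auto simp: scaleR_add_right scaleR_add_left inner_add_left
      inner_add_right inner_commute power2_norm_eq_inner elim!: Reals_cases)

lemma hilbert_space_complex: "hilbert_space UNIV (*) (\<lambda>x y. x * cnj y)"
  by unfold_locales
    (auto simp: scaleR_conv_of_real algebra_simps complex_norm_square simp del: of_real_power)

section \<open>Bochner integral without separability\<close>

text \<open>
  The library's \<^const>\<open>has_bochner_integral\<close> requires a second-countable codomain, i.e. a separable
  space. The following is the same definition with Borel measurability replaced by strong
  measurability, which makes it meaningful in arbitrary normed spaces. Strong measurability cannot
  be dropped: \<^const>\<open>nn_integral\<close> is a lower integral on non-measurable functions.
\<close>

definition strongly_measurable :: "'a measure \<Rightarrow> ('a \<Rightarrow> 'b::real_normed_vector) \<Rightarrow> bool" where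
  "strongly_measurable M f \<longleftrightarrow>
     (\<exists>s. (\<forall>i::nat. simple_function M (s i)) \<and> (AE x in M. (\<lambda>i. s i x) \<longlonglongrightarrow> f x))"

definition has_strong_bochner_integral ::
    "'a measure \<Rightarrow> ('a \<Rightarrow> 'b::real_normed_vector) \<Rightarrow> 'b \<Rightarrow> bool" where
  "has_strong_bochner_integral M f I \<longleftrightarrow> strongly_measurable M f \<and>
     (\<exists>s. (\<forall>i::nat. Bochner_Integration.simple_bochner_integrable M (s i)) \<and>
          (\<lambda>i. \<integral>\<^sup>+x. ennreal (norm (f x - s i x)) \<partial>M) \<longlonglongrightarrow> 0 \<and>
          (\<lambda>i. Bochner_Integration.simple_bochner_integral M (s i)) \<longlonglongrightarrow> I)"

definition strong_bochner_integrable :: "'a measure \<Rightarrow> ('a \<Rightarrow> 'b::real_normed_vector) \<Rightarrow> bool" where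
  "strong_bochner_integrable M f \<longleftrightarrow> (\<exists>I. has_strong_bochner_integral M f I)"

definition strong_bochner_integral :: "'a measure \<Rightarrow> ('a \<Rightarrow> 'b::real_normed_vector) \<Rightarrow> 'b" where
  "strong_bochner_integral M f = (THE I. has_strong_bochner_integral M f I)"

lemma strongly_measurable_norm_diff_AE:
  fixes f :: "'a \<Rightarrow> 'b::real_normed_vector"
  assumes f: "strongly_measurable M f" and t: "simple_function M t"
  obtains g :: "'a \<Rightarrow> ennreal"
    where "g \<in> borel_measurable M" "AE x in M. ennreal (norm (f x - t x)) = g x"
proof -
  obtain s where s: "\<And>i::nat. simple_function M (s i)"
    and lim: "AE x in M. (\<lambda>i. s i x) \<longlonglongrightarrow> f x"
    using f unfolding strongly_measurable_def by auto
  define g where "g x = liminf (\<lambda>i. ennreal (norm (s i x - t x)))" for x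
  have "simple_function M (\<lambda>x. ennreal (norm (s i x - t x)))" for i
    using simple_function_compose2[OF s[of i] t, of "\<lambda>u v. ennreal (norm (u - v))"] .
  then have "(\<lambda>x. ennreal (norm (s i x - t x))) \<in> borel_measurable M" for i
    by (rule borel_measurable_simple_function)
  then have "g \<in> borel_measurable M"
    unfolding g_def by measurable
  moreover have "AE x in M. ennreal (norm (f x - t x)) = g x"
    using lim
  proof eventually_elim
    case (elim x)
    then have "(\<lambda>i. ennreal (norm (s i x - t x))) \<longlonglongrightarrow> ennreal (norm (f x - t x))"
      by (intro tendsto_intros)
    then show ?case
      unfolding g_def by (rule lim_imp_Liminf[OF trivial_limit_sequentially, symmetric])
  qed
  ultimately show ?thesis by (rule that)
qed

lemma simple_bochner_integral_dist_le:
  fixes f :: "'a \<Rightarrow> 'b::real_normed_vector"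
  assumes f: "strongly_measurable M f"
    and s: "Bochner_Integration.simple_bochner_integrable M s" and t: "Bochner_Integration.simple_bochner_integrable M t"
  shows "ennreal (norm (Bochner_Integration.simple_bochner_integral M s - Bochner_Integration.simple_bochner_integral M t)) \<le>
    (\<integral>\<^sup>+x. ennreal (norm (f x - s x)) \<partial>M) + (\<integral>\<^sup>+x. ennreal (norm (f x - t x)) \<partial>M)"
proof -
  have sf: "simple_function M s" "simple_function M t"
    using s t by (auto elim: simple_bochner_integrable.cases)
  have st: "Bochner_Integration.simple_bochner_integrable M (\<lambda>x. s x - t x)"
    using simple_bochner_integrable_compose2[OF _ s t, of "\<lambda>x y. x - y"] by simp
  obtain g where g: "g \<in> borel_measurable M" "AE x in M. ennreal (norm (f x - s x)) = g x"
    using strongly_measurable_norm_diff_AE[OF f sf(1)] by blast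
  obtain h where h: "h \<in> borel_measurable M" "AE x in M. ennreal (norm (f x - t x)) = h x"
    using strongly_measurable_norm_diff_AE[OF f sf(2)] by blast
  have "ennreal (norm (Bochner_Integration.simple_bochner_integral M s - Bochner_Integration.simple_bochner_integral M t)) =
      ennreal (norm (Bochner_Integration.simple_bochner_integral M (\<lambda>x. s x - t x)))"
    using s t by (simp add: simple_bochner_integral_diff)
  also have "\<dots> \<le> ennreal (Bochner_Integration.simple_bochner_integral M (\<lambda>x. norm (s x - t x)))"
    by (intro ennreal_leI simple_bochner_integral_norm_bound st)
  also have "\<dots> = (\<integral>\<^sup>+x. ennreal (norm (s x - t x)) \<partial>M)"
    using simple_bochner_integrable_compose2[OF _ s t, of "\<lambda>x y. norm (x - y)"]
    by (intro simple_bochner_integral_eq_nn_integral) auto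
  also have "\<dots> \<le> (\<integral>\<^sup>+x. g x + h x \<partial>M)"
  proof (rule nn_integral_mono_AE)
    show "AE x in M. ennreal (norm (s x - t x)) \<le> g x + h x"
      using g(2) h(2)
    proof eventually_elim
      case (elim x)
      have "norm (s x - t x) \<le> norm (f x - s x) + norm (f x - t x)"
        using norm_triangle_ineq4[of "f x - t x" "f x - s x"] by simp
      then have "ennreal (norm (s x - t x)) \<le> ennreal (norm (f x - s x) + norm (f x - t x))"
        by (rule ennreal_leI)
      then show ?case
        using elim by simp
    qed
  qed
  also have "\<dots> = (\<integral>\<^sup>+x. g x \<partial>M) + (\<integral>\<^sup>+x. h x \<partial>M)"
    using g(1) h(1) by (rule nn_integral_add)
  also have "(\<integral>\<^sup>+x. g x \<partial>M) = (\<integral>\<^sup>+x. ennreal (norm (f x - s x)) \<partial>M)"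
    using g(2) by (intro nn_integral_cong_AE) auto
  also have "(\<integral>\<^sup>+x. h x \<partial>M) = (\<integral>\<^sup>+x. ennreal (norm (f x - t x)) \<partial>M)"
    using h(2) by (intro nn_integral_cong_AE) auto
  finally show ?thesis .
qed

lemma has_strong_bochner_integral_unique:
  assumes I: "has_strong_bochner_integral M f I" and J: "has_strong_bochner_integral M f J"
  shows "I = J"
proof -
  have f: "strongly_measurable M f"
    using I by (simp add: has_strong_bochner_integral_def)
  obtain s where s: "\<And>i::nat. Bochner_Integration.simple_bochner_integrable M (s i)"
    "(\<lambda>i. \<integral>\<^sup>+x. ennreal (norm (f x - s i x)) \<partial>M) \<longlonglongrightarrow> 0"
    "(\<lambda>i. Bochner_Integration.simple_bochner_integral M (s i)) \<longlonglongrightarrow> I"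
    using I unfolding has_strong_bochner_integral_def by auto
  obtain t where t: "\<And>i::nat. Bochner_Integration.simple_bochner_integrable M (t i)"
    "(\<lambda>i. \<integral>\<^sup>+x. ennreal (norm (f x - t i x)) \<partial>M) \<longlonglongrightarrow> 0"
    "(\<lambda>i. Bochner_Integration.simple_bochner_integral M (t i)) \<longlonglongrightarrow> J"
    using J unfolding has_strong_bochner_integral_def by auto
  let ?d = "\<lambda>i. norm (Bochner_Integration.simple_bochner_integral M (s i) - Bochner_Integration.simple_bochner_integral M (t i))"
  have "(\<lambda>i. ennreal (?d i)) \<longlonglongrightarrow> 0"
  proof (rule tendsto_sandwich[OF _ _ tendsto_const])
    show "\<forall>\<^sub>F i in sequentially. 0 \<le> ennreal (?d i)"
      by simp
    show "\<forall>\<^sub>F i in sequentially. ennreal (?d i) \<le>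
      (\<integral>\<^sup>+x. ennreal (norm (f x - s i x)) \<partial>M) + (\<integral>\<^sup>+x. ennreal (norm (f x - t i x)) \<partial>M)"
      by (intro always_eventually allI simple_bochner_integral_dist_le f s t)
    show "(\<lambda>i. (\<integral>\<^sup>+x. ennreal (norm (f x - s i x)) \<partial>M) +
        (\<integral>\<^sup>+x. ennreal (norm (f x - t i x)) \<partial>M)) \<longlonglongrightarrow> 0"
      using tendsto_add[OF s(2) t(2)] by simp
  qed
  then have "?d \<longlonglongrightarrow> 0"
    by (simp flip: ennreal_0)
  moreover have "?d \<longlonglongrightarrow> norm (I - J)"
    by (intro tendsto_intros s t)
  ultimately have "norm (I - J) = 0"
    by (metis LIMSEQ_unique)
  then show ?thesis by simp
qed

lemma strong_bochner_integral_eqI: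
  "has_strong_bochner_integral M f I \<Longrightarrow> strong_bochner_integral M f = I"
  unfolding strong_bochner_integral_def
  by (rule the_equality, assumption) (rule has_strong_bochner_integral_unique)

lemma has_bochner_integral_imp_strong:
  fixes f :: "'a \<Rightarrow> 'b::{real_normed_vector,second_countable_topology}"
  assumes "has_bochner_integral M f I"
  shows "has_strong_bochner_integral M f I"
  using assms
proof (cases rule: has_bochner_integral.cases)
  case (1 s)
  obtain u where "\<And>i::nat. simple_function M (u i)"
    "\<And>x. x \<in> space M \<Longrightarrow> (\<lambda>i. u i x) \<longlonglongrightarrow> f x"
    using borel_measurable_implies_sequence_metric[OF 1(1), of 0] by blast
  then have "strongly_measurable M f"
    unfolding strongly_measurable_def by (intro exI[of _ u]) auto
  with 1 show ?thesis
    unfolding has_strong_bochner_integral_def by blast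
qed

lemma strong_bochner_integral_eq_lebesgue_integral:
  fixes f :: "'a \<Rightarrow> 'b::{banach,second_countable_topology}"
  assumes "integrable M f"
  shows "strong_bochner_integral M f = integral\<^sup>L M f"
  by (intro strong_bochner_integral_eqI has_bochner_integral_imp_strong
      has_bochner_integral_integrable assms)

end

theory Submission
  imports Defs
begin

text \<open>
  Write \<open>A = \<integral>\<parallel>f\<parallel> - (1/n) \<Sum>i. \<integral>M i\<close>, \<open>v = \<integral>f\<close> and \<open>w = \<Sum>i. e i\<close>. Integrating the hypotheses and adding
  them up gives \<open>n A \<le> Re \<langle>v, w\<rangle>\<close>, because \<open>Re \<langle>\<cdot>, e i\<rangle>\<close> is a bounded \<open>\<real>\<close>-linear functional and
  therefore commutes with the Bochner integral (lemma
  \<open>has_bochner_integral_bounded_linear_strong\<close>). Orthonormality gives \<open>\<parallel>w\<parallel> = \<surd>n\<close>, so Cauchy--Schwarz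
  yields \<open>n A \<le> \<surd>n \<parallel>v\<parallel>\<close>, which is the inequality.

  The case of equality is the one in Cauchy--Schwarz: if \<open>A = \<parallel>v\<parallel> / \<surd>n\<close>, then
  \<open>\<parallel>v - A w\<parallel>\<^sup>2 = \<parallel>v\<parallel>\<^sup>2 - 2 A Re \<langle>v, w\<rangle> + A\<^sup>2 n \<le> n A\<^sup>2 - 2 n A\<^sup>2 + n A\<^sup>2 = 0\<close>.
  This part is pure Hilbert space geometry (lemma \<open>scaled_lower_bound_equality_iff\<close>).

  The analytic work lies in passing from the Bochner integral in a possibly non-separable space,
  defined through strong measurability, to ordinary integrals of real functions. Strong
  measurability only provides limits of simple functions almost everywhere; completeness of the
  Lebesgue measure turns these into measurable real functions.
\<close>

section \<open>Strongly measurable functions over a complete measure\<close>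

context complete_measure
begin

text \<open>
  Convergence may fail on a null set, where the limit function is arbitrary; by completeness, the
  values there do not affect measurability.
\<close>

lemma borel_measurable_AE_LIMSEQ:
  fixes u :: "nat \<Rightarrow> 'a \<Rightarrow> 'c::real_normed_vector"
  assumes u: "\<And>i. u i \<in> borel_measurable M"
    and lim: "AE x in M. (\<lambda>i. u i x) \<longlonglongrightarrow> g x"
  shows "g \<in> borel_measurable M"
proof -
  define N where "N = {x \<in> space M. \<not> (\<lambda>i. u i x) \<longlonglongrightarrow> g x}"
  have N: "N \<in> null_sets M"
    using lim by (simp add: N_def AE_iff_null_sets)
  define h where "h x = (if x \<in> N then 0 else g x)" for x
  have [measurable]: "N \<in> sets M" "u i \<in> borel_measurable M" for i
    using N u by auto
  have h: "h \<in> borel_measurable M"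
  proof (rule borel_measurable_LIMSEQ_metric)
    show "(\<lambda>x. if x \<in> N then 0 else u i x) \<in> borel_measurable M" for i
      by measurable
    show "(\<lambda>i. if x \<in> N then 0 else u i x) \<longlonglongrightarrow> h x" if "x \<in> space M" for x
      using that by (auto simp: h_def N_def)
  qed
  have eq: "AE x in M. h x = g x"
    using AE_not_in[OF N] by eventually_elim (simp add: h_def)
  show ?thesis
  proof (rule measurableI)
    fix S :: "'c set" assume "S \<in> sets borel"
    then have "h -` S \<inter> space M \<in> sets M"
      using h by (rule measurable_sets[rotated])
    moreover have "AE x in M. x \<in> h -` S \<inter> space M \<longleftrightarrow> x \<in> g -` S \<inter> space M"
      using eq by eventually_elim simp
    ultimately show "g -` S \<inter> space M \<in> sets M"
      using in_sets_AE by blast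
  qed simp
qed

lemma strongly_measurable_continuous_compose:
  fixes \<phi> :: "'b::real_normed_vector \<Rightarrow> 'c::real_normed_vector"
  assumes f: "strongly_measurable M f" and \<phi>: "continuous_on UNIV \<phi>"
  shows "(\<lambda>x. \<phi> (f x)) \<in> borel_measurable M"
proof -
  obtain s where s: "\<And>i::nat. simple_function M (s i)"
    and lim: "AE x in M. (\<lambda>i. s i x) \<longlonglongrightarrow> f x"
    using f unfolding strongly_measurable_def by auto
  show ?thesis
  proof (rule borel_measurable_AE_LIMSEQ)
    show "(\<lambda>x. \<phi> (s i x)) \<in> borel_measurable M" for i
      using s by (rule borel_measurable_simple_function[OF simple_function_compose1])
    show "AE x in M. (\<lambda>i. \<phi> (s i x)) \<longlonglongrightarrow> \<phi> (f x)"
      using lim by eventually_elim (rule continuous_on_tendsto_compose[OF \<phi>], auto)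
  qed
qed

lemma strongly_measurable_diff_simple:
  fixes f :: "'a \<Rightarrow> 'b::real_normed_vector"
  assumes f: "strongly_measurable M f" and t: "simple_function M t"
  shows "strongly_measurable M (\<lambda>x. f x - t x)"
proof -
  obtain s where s: "\<And>i::nat. simple_function M (s i)"
    and lim: "AE x in M. (\<lambda>i. s i x) \<longlonglongrightarrow> f x"
    using f unfolding strongly_measurable_def by auto
  have "simple_function M (\<lambda>x. s i x - t x)" for i
    using s t by (rule simple_function_compose2)
  moreover have "AE x in M. (\<lambda>i. s i x - t x) \<longlonglongrightarrow> f x - t x"
    using lim by eventually_elim (intro tendsto_intros)
  ultimately show ?thesis
    unfolding strongly_measurable_def by (intro exI[of _ "\<lambda>i x. s i x - t x"]) auto
qed

lemma borel_measurable_norm_diff_simple: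
  fixes f :: "'a \<Rightarrow> 'b::real_normed_vector"
  assumes "strongly_measurable M f" "simple_function M t"
  shows "(\<lambda>x. norm (f x - t x)) \<in> borel_measurable M"
  by (rule strongly_measurable_continuous_compose[OF
        strongly_measurable_diff_simple[OF assms] continuous_on_norm_id])

section \<open>Scalar integrals obtained from the Bochner integral\<close>

lemma strong_bochner_integrable_norm:
  fixes f :: "'a \<Rightarrow> 'b::real_normed_vector"
  assumes "strong_bochner_integrable M f"
  shows "integrable M (\<lambda>x. norm (f x))"
proof -
  obtain s where f: "strongly_measurable M f"
    and s: "\<And>i::nat. Bochner_Integration.simple_bochner_integrable M (s i)"
    and lim: "(\<lambda>i. \<integral>\<^sup>+x. ennreal (norm (f x - s i x)) \<partial>M) \<longlonglongrightarrow> 0"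
    using assms unfolding strong_bochner_integrable_def has_strong_bochner_integral_def by auto
  have "\<forall>\<^sub>F i in sequentially. (\<integral>\<^sup>+x. ennreal (norm (f x - s i x)) \<partial>M) < \<infinity>"
    using lim by (rule order_tendstoD) simp
  then obtain i where i: "(\<integral>\<^sup>+x. ennreal (norm (f x - s i x)) \<partial>M) < \<infinity>"
    by (auto simp: eventually_sequentially)
  have si: "simple_function M (s i)"
    using s[of i] by (auto elim: simple_bochner_integrable.cases)
  have norm_si: "Bochner_Integration.simple_bochner_integrable M (\<lambda>x. norm (s i x))"
    using simple_bochner_integrable_compose2[OF _ s[of i] s[of i], of "\<lambda>x y. norm x"] by simp
  have [measurable]: "(\<lambda>x. norm (f x - s i x)) \<in> borel_measurable M"
    using f si by (rule borel_measurable_norm_diff_simple)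
  have [measurable]: "(\<lambda>x. norm (s i x)) \<in> borel_measurable M"
    using si by (rule borel_measurable_simple_function[OF simple_function_compose1])
  show ?thesis
  proof (rule integrableI_bounded)
    show "(\<lambda>x. norm (f x)) \<in> borel_measurable M"
      by (rule strongly_measurable_continuous_compose[OF f continuous_on_norm_id])
    have "(\<integral>\<^sup>+x. ennreal (norm (norm (f x))) \<partial>M)
        \<le> (\<integral>\<^sup>+x. ennreal (norm (f x - s i x)) + ennreal (norm (s i x)) \<partial>M)"
    proof (rule nn_integral_mono)
      show "ennreal (norm (norm (f x))) \<le> ennreal (norm (f x - s i x)) + ennreal (norm (s i x))"
        for x
        using norm_triangle_sub[of "f x" "s i x"]
        by (simp add: ennreal_leI add.commute flip: ennreal_plus)
    qed
    also have "\<dots> = (\<integral>\<^sup>+x. ennreal (norm (f x - s i x)) \<partial>M) + (\<integral>\<^sup>+x. ennreal (norm (s i x)) \<partial>M)"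
      by (rule nn_integral_add) measurable
    also have "(\<integral>\<^sup>+x. ennreal (norm (s i x)) \<partial>M)
        = ennreal (Bochner_Integration.simple_bochner_integral M (\<lambda>x. norm (s i x)))"
      by (rule simple_bochner_integral_eq_nn_integral[symmetric, OF norm_si]) simp
    finally show "(\<integral>\<^sup>+x. ennreal (norm (norm (f x))) \<partial>M) < \<infinity>"
      by (rule le_less_trans) (use i in \<open>simp add: less_top\<close>)
  qed
qed

text \<open>
  If simple functions \<open>s i\<close> approximate \<open>f\<close> in mean, then the simple functions \<open>T (s i)\<close> approximate
  \<open>T f\<close> in mean, with the error multiplied by at most the operator norm of \<open>T\<close>. Separability
  is only asked of the codomain, so that the integral of \<open>T f\<close> is an ordinary one even when \<open>f\<close> takes
  values in a non-separable space.
\<close>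

lemma has_bochner_integral_bounded_linear_strong:
  fixes T :: "'b::real_normed_vector \<Rightarrow> 'c::{real_normed_vector,second_countable_topology}"
  assumes f: "has_strong_bochner_integral M f I" and "bounded_linear T"
  shows "has_bochner_integral M (\<lambda>x. T (f x)) (T I)"
proof -
  interpret T: bounded_linear T by fact
  obtain s where meas: "strongly_measurable M f"
    and s: "\<And>i::nat. Bochner_Integration.simple_bochner_integrable M (s i)"
    and lim: "(\<lambda>i. \<integral>\<^sup>+x. ennreal (norm (f x - s i x)) \<partial>M) \<longlonglongrightarrow> 0"
    and int: "(\<lambda>i. Bochner_Integration.simple_bochner_integral M (s i)) \<longlonglongrightarrow> I"
    using f unfolding has_strong_bochner_integral_def by auto
  obtain B where B: "B > 0" "\<And>x. norm (T x) \<le> norm x * B"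
    using T.pos_bounded by auto
  show ?thesis
  proof (rule has_bochner_integral.intros)
    show "(\<lambda>x. T (f x)) \<in> borel_measurable M"
      using meas by (rule strongly_measurable_continuous_compose) (intro T.continuous_on continuous_on_id)
    show "Bochner_Integration.simple_bochner_integrable M (\<lambda>x. T (s i x))" for i
      using simple_bochner_integrable_compose2[OF _ s[of i] s[of i], of "\<lambda>x y. T x"]
      by (simp add: T.zero)
    show "(\<lambda>i. \<integral>\<^sup>+x. ennreal (norm (T (f x) - T (s i x))) \<partial>M) \<longlonglongrightarrow> 0"
    proof (rule tendsto_sandwich[OF _ _ tendsto_const])
      show "\<forall>\<^sub>F i in sequentially. (\<integral>\<^sup>+x. ennreal (norm (T (f x) - T (s i x))) \<partial>M)
          \<le> ennreal B * (\<integral>\<^sup>+x. ennreal (norm (f x - s i x)) \<partial>M)"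
      proof (intro always_eventually allI)
        fix i
        have [measurable]: "(\<lambda>x. norm (f x - s i x)) \<in> borel_measurable M"
          using s[of i]
          by (intro borel_measurable_norm_diff_simple meas)
            (auto elim: simple_bochner_integrable.cases)
        have "(\<integral>\<^sup>+x. ennreal (norm (T (f x) - T (s i x))) \<partial>M)
            \<le> (\<integral>\<^sup>+x. ennreal B * ennreal (norm (f x - s i x)) \<partial>M)"
          using B by (intro nn_integral_mono)
            (auto simp: T.diff[symmetric] ac_simps ennreal_mult[symmetric] intro!: ennreal_leI)
        also have "\<dots> = ennreal B * (\<integral>\<^sup>+x. ennreal (norm (f x - s i x)) \<partial>M)"
          by (rule nn_integral_cmult) measurable
        finally show "(\<integral>\<^sup>+x. ennreal (norm (T (f x) - T (s i x))) \<partial>M)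
            \<le> ennreal B * (\<integral>\<^sup>+x. ennreal (norm (f x - s i x)) \<partial>M)" .
      qed
      show "(\<lambda>i. ennreal B * (\<integral>\<^sup>+x. ennreal (norm (f x - s i x)) \<partial>M)) \<longlonglongrightarrow> 0"
        using ennreal_tendsto_cmult[OF _ lim, of "ennreal B"] by simp
    qed simp
    show "(\<lambda>i. Bochner_Integration.simple_bochner_integral M (\<lambda>x. T (s i x))) \<longlonglongrightarrow> T I"
      using T.tendsto[OF int] s by (simp add: simple_bochner_integral_linear T.linear_axioms)
  qed
qed

end

lemma complete_measure_lebesgue_on:
  assumes "S \<in> sets lebesgue"
  shows "complete_measure (lebesgue_on S)"
proof
  fix A B :: "'a set"
  assume "B \<subseteq> A" "A \<in> null_sets (lebesgue_on S)"
  then have "B \<in> null_sets (lebesgue_on S)"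
    using assms completion.complete2[of B A lborel]
    by (auto simp: null_sets_restrict_space)
  then show "B \<in> sets (lebesgue_on S)"
    by auto
qed

section \<open>Real parts of the inner product\<close>

context hilbert_space
begin

lemma ip_scaleR_left: "ip (r *\<^sub>R x) y = of_real r * ip x y"
proof -
  have "complex_of_real r \<in> K"
    using K_cases by auto
  then show ?thesis
    using ip_scl_left[of "complex_of_real r" x y] by (simp add: scl_of_real)
qed

lemma Re_ip_commute: "Re (ip x y) = Re (ip y x)"
  by (subst ip_commute) simp

lemma ip_add_right: "ip x (y + z) = ip x y + ip x z"
  by (subst (1 2 3) ip_commute) (simp add: ip_add_left)

lemma ip_sum_right: "finite I \<Longrightarrow> ip x (\<Sum>i\<in>I. e i) = (\<Sum>i\<in>I. ip x (e i))"
proof (induction I rule: finite_induct)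
  case empty
  show ?case
    using ip_add_right[of x 0 0] by simp
qed (simp add: ip_add_right)

lemma power2_norm_add: "(norm (x + y))\<^sup>2 = (norm x)\<^sup>2 + 2 * Re (ip x y) + (norm y)\<^sup>2"
proof -
  have "complex_of_real ((norm (x + y))\<^sup>2) = ip x x + ip x y + ip y x + ip y y"
    unfolding ip_self[symmetric] by (simp add: ip_add_left ip_add_right)
  then have "Re (complex_of_real ((norm (x + y))\<^sup>2)) = Re (ip x x + ip x y + ip y x + ip y y)"
    by (rule arg_cong)
  then show ?thesis
    by (simp add: ip_self Re_ip_commute[of y x] del: of_real_power)
qed

text \<open>
  Since the norm is given, Cauchy--Schwarz is just its triangle inequality, squared.
\<close>

lemma Re_ip_le_norm: "Re (ip x y) \<le> norm x * norm y"
proof -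
  have "(norm (x + y))\<^sup>2 \<le> (norm x + norm y)\<^sup>2"
    by (intro power_mono norm_triangle_ineq) simp
  then show ?thesis
    unfolding power2_norm_add by (simp add: power2_sum)
qed

lemma bounded_linear_Re_ip: "bounded_linear (\<lambda>x. Re (ip x y))"
proof
  show "\<exists>B. \<forall>x. norm (Re (ip x y)) \<le> norm x * B"
  proof (intro exI allI)
    show "norm (Re (ip x y)) \<le> norm x * norm y" for x
      using Re_ip_le_norm[of x y] Re_ip_le_norm[of "- x" y] ip_scaleR_left[of "-1" x y] by simp
  qed
qed (simp_all add: ip_add_left ip_scaleR_left)

lemma power2_norm_sum_orthonormal:
  assumes "finite I" "orthonormal_family I e"
  shows "(norm (\<Sum>i\<in>I. e i))\<^sup>2 = card I"
  using assms
proof (induction I rule: finite_induct)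
  case (insert j I)
  have "ip (e j) (\<Sum>i\<in>I. e i) = 0"
    unfolding ip_sum_right[OF insert.hyps(1)]
    using insert.hyps insert.prems by (intro sum.neutral) (auto simp: orthonormal_family_def)
  moreover have "(norm (\<Sum>i\<in>I. e i))\<^sup>2 = card I" "norm (e j) = 1"
    using insert by (auto simp: orthonormal_family_def)
  ultimately show ?case
    using insert.hyps by (simp add: power2_norm_add)
qed simp

text \<open>
  Cauchy--Schwarz against \<open>w\<close>, together with its case of equality: here \<open>A\<close> is a lower bound for the
  coefficient \<open>Re \<langle>v, w\<rangle> / \<parallel>w\<parallel>\<^sup>2\<close> of the projection of \<open>v\<close> onto \<open>w\<close>. If \<open>A \<parallel>w\<parallel>\<close> reaches \<open>\<parallel>v\<parallel>\<close>, that
  projection is as long as \<open>v\<close>, so \<open>v\<close> coincides with it.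
\<close>

lemma scaled_lower_bound_equality_iff:
  assumes w: "w \<noteq> 0" and A: "A * (norm w)\<^sup>2 \<le> Re (ip v w)"
  shows "A \<le> norm v / norm w"
    and "A = norm v / norm w \<longleftrightarrow> 0 \<le> A \<and> v = A *\<^sub>R w"
proof -
  have pos: "norm w > 0"
    using w by simp
  have "(A * norm w) * norm w \<le> norm v * norm w"
    using A Re_ip_le_norm[of v w] by (simp add: power2_eq_square mult.assoc)
  then show "A \<le> norm v / norm w"
    using pos by (simp add: pos_le_divide_eq)
  show "A = norm v / norm w \<longleftrightarrow> 0 \<le> A \<and> v = A *\<^sub>R w"
  proof
    assume eq: "A = norm v / norm w"
    then have "0 \<le> A"
      by simp
    have v: "norm v = A * norm w"
      using eq pos by simp
    have "Re (ip v ((- A) *\<^sub>R w)) = - A * Re (ip v w)"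
      unfolding Re_ip_commute[of v] by (simp only: ip_scaleR_left) simp
    then have "(norm (v + (- A) *\<^sub>R w))\<^sup>2
        = (A * norm w)\<^sup>2 - 2 * (A * Re (ip v w)) + (A * norm w)\<^sup>2"
      by (simp only: power2_norm_add v) (simp add: power_mult_distrib)
    also have "\<dots> \<le> 0"
      using mult_left_mono[OF A \<open>0 \<le> A\<close>] by (simp add: power2_eq_square algebra_simps)
    finally have "v - A *\<^sub>R w = 0"
      by simp
    with \<open>0 \<le> A\<close> show "0 \<le> A \<and> v = A *\<^sub>R w"
      by simp
  qed (use pos in auto)
qed

end

section \<open>The reverse triangle inequality\<close>

theorem theorem3:
  fixes K :: "complex set"
    and scl :: "complex \<Rightarrow> 'h::banach \<Rightarrow> 'h"
    and ip :: "'h \<Rightarrow> 'h \<Rightarrow> complex"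
    and a b :: real
    and n :: nat
    and f :: "real \<Rightarrow> 'h"
    and e :: "nat \<Rightarrow> 'h"
    and M :: "nat \<Rightarrow> real \<Rightarrow> real"
  assumes "hilbert_space K scl ip"
    and "a < b"
    and "n \<ge> 1"
    and "strong_bochner_integrable (lebesgue_on {a..b}) f"
    and "hilbert_space.orthonormal_family ip {1..n} e"
    and "\<And>i. i \<in> {1..n} \<Longrightarrow> integrable (lebesgue_on {a..b}) (M i)"
    and "\<And>i. i \<in> {1..n} \<Longrightarrow>
           AE t in lebesgue_on {a..b}. norm (f t) - Re (ip (f t) (e i)) \<le> M i t"
  shows
    "(\<integral>t. norm (f t) \<partial>lebesgue_on {a..b})
       \<le> 1 / sqrt (real n) * norm (strong_bochner_integral (lebesgue_on {a..b}) f)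
         + 1 / real n * (\<Sum>i=1..n. \<integral>t. M i t \<partial>lebesgue_on {a..b})
     \<and>
     ((\<integral>t. norm (f t) \<partial>lebesgue_on {a..b})
       = 1 / sqrt (real n) * norm (strong_bochner_integral (lebesgue_on {a..b}) f)
         + 1 / real n * (\<Sum>i=1..n. \<integral>t. M i t \<partial>lebesgue_on {a..b})
      \<longleftrightarrow>
      (\<integral>t. norm (f t) \<partial>lebesgue_on {a..b})
        \<ge> 1 / real n * (\<Sum>i=1..n. \<integral>t. M i t \<partial>lebesgue_on {a..b})
      \<and>
      strong_bochner_integral (lebesgue_on {a..b}) f
        = ((\<integral>t. norm (f t) \<partial>lebesgue_on {a..b})
             - 1 / real n * (\<Sum>i=1..n. \<integral>t. M i t \<partial>lebesgue_on {a..b}))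
          *\<^sub>R (\<Sum>i=1..n. e i))"
proof -
  interpret hilbert_space K scl ip by fact
  let ?L = "lebesgue_on {a..b}"
  interpret L: complete_measure ?L
    by (rule complete_measure_lebesgue_on) simp
  define v where "v = strong_bochner_integral ?L f"
  define w where "w = (\<Sum>i=1..n. e i)"
  define F where "F = (\<integral>t. norm (f t) \<partial>?L)"
  define m where "m = 1 / real n * (\<Sum>i=1..n. \<integral>t. M i t \<partial>?L)"
  have n: "real n > 0"
    using assms(3) by simp
  have v: "has_strong_bochner_integral ?L f v"
    using assms(4) strong_bochner_integral_eqI
    unfolding strong_bochner_integrable_def v_def by metis
  have w: "(norm w)\<^sup>2 = real n"
    using power2_norm_sum_orthonormal[OF _ assms(5)] by (simp add: w_def)
  then have norm_w: "norm w = sqrt (real n)"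
    by (metis norm_ge_zero real_sqrt_unique)
  have "F - Re (ip v (e i)) \<le> (\<integral>t. M i t \<partial>?L)" if i: "i \<in> {1..n}" for i
  proof -
    have norm_f: "integrable ?L (\<lambda>t. norm (f t))"
      by (rule L.strong_bochner_integrable_norm[OF assms(4)])
    have Re_f: "has_bochner_integral ?L (\<lambda>t. Re (ip (f t) (e i))) (Re (ip v (e i)))"
      using v bounded_linear_Re_ip by (rule L.has_bochner_integral_bounded_linear_strong)
    have "F - Re (ip v (e i)) = (\<integral>t. norm (f t) - Re (ip (f t) (e i)) \<partial>?L)"
      using norm_f Re_f by (simp add: F_def has_bochner_integral_iff)
    also have "\<dots> \<le> (\<integral>t. M i t \<partial>?L)"
      using norm_f Re_f assms(6,7)[OF i]
      by (intro integral_mono_AE) (auto simp: has_bochner_integral_iff)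
    finally show ?thesis .
  qed
  then have "(\<Sum>i=1..n. F - Re (ip v (e i))) \<le> (\<Sum>i=1..n. \<integral>t. M i t \<partial>?L)"
    by (rule sum_mono)
  also have "\<dots> = real n * m"
    using n by (simp add: m_def)
  finally have "(F - m) * (norm w)\<^sup>2 \<le> Re (ip v w)"
    unfolding w by (simp add: w_def ip_sum_right sum_subtractf algebra_simps)
  moreover have "w \<noteq> 0"
    using n w by auto
  ultimately have bound: "F - m \<le> norm v / norm w"
    and equality: "F - m = norm v / norm w \<longleftrightarrow> 0 \<le> F - m \<and> v = (F - m) *\<^sub>R w"
    using scaled_lower_bound_equality_iff[of w "F - m" v] by auto
  have "F \<le> 1 / sqrt (real n) * norm v + m"
    using bound by (simp add: norm_w)
  moreover have "F = 1 / sqrt (real n) * norm v + m \<longleftrightarrow> F \<ge> m \<and> v = (F - m) *\<^sub>R w"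
    using equality by (simp add: norm_w diff_eq_eq)
  ultimately show ?thesis
    unfolding F_def m_def v_def w_def by blast
qed

end
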